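(* Let $(\alpha,m)\in(0,1]^2$, let $g:[0,\infty)\to\mathbb{R}$ be an $(\alpha,m)$-convex function, let $f:[0,\infty)\to\mathbb{R}$ be a $(g-(\alpha,m))$-convex dominated function, and let $0\le a<b$. If $f\in L_1[a,b]$, then $$\left|\frac12\left[\frac{f(a)+f(b)+m\alpha f\left(\frac{a}{m}\right)+m\alpha f\left(\frac{b}{m}\right)}{\alpha+1}\right]-\frac{1}{b-a}\int_a^b f(x)\,dx\right|$$ $$\le\frac12\left[\frac{g(a)+g(b)+m\alpha g\left(\frac{a}{m}\right)+m\alpha g\left(\frac{b}{m}\right)}{\alpha+1}\right]-\frac{1}{b-a}\int_a^b g(x)\,dx.$$
   Context: Let $J$ be $[0,c]$ with $c>0$, or $[0,\infty)$, and let $(\alpha,m)\in[0,1]^2$ be fixed. A function $g:J\to\mathbb{R}$ is $(\alpha,m)$-convex if $g(tx+m(1-t)y)\le t^\alpha g(x)+m(1-t^\alpha)g(y)$ for all $x,y\in J$ and $t\in[0,1]$. Given an $(\alpha,m)$-convex function $g:J\to\mathbb{R}$, a function $f:J\to\mathbb{R}$ is called $(g-(\alpha,m))$-convex dominated on $J$ if $$\left|\lambda^\alpha f(x)+m(1-\lambda^\alpha)f(y)-f(\lambda x+m(1-\lambda)y)\right|\le\lambda^\alpha g(x)+m(1-\lambda^\alpha)g(y)-g(\lambda x+m(1-\lambda)y)$$ for all $x,y\in J$ and $\lambda\in[0,1]$. $L_1[a,b]$ denotes the Lebesgue integrable functions on $[a,b]$. *)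

theory Defs
  imports "HOL-Analysis.Analysis"
begin

text \<open>
  The domain \<open>J\<close> is meant to be \<open>{0..c}\<close> with \<open>c > 0\<close>, or \<open>{0..}\<close>, and
  \<open>\<alpha>\<close>, \<open>m\<close> are meant to lie in \<open>{0..1}\<close>; then \<open>t * x + m * (1 - t) * y\<close> stays in \<open>J\<close>.
  Since \<open>0 powr 0 = 0\<close>, the endpoint \<open>t = 0\<close> with \<open>\<alpha> = 0\<close> does not follow the
  convention \<open>0\<^sup>0 = 1\<close>; for \<open>\<alpha> > 0\<close> the function \<open>powr\<close> is the usual power on \<open>{0..1}\<close>.
\<close>

definition am_convex_on :: "real set \<Rightarrow> real \<Rightarrow> real \<Rightarrow> (real \<Rightarrow> real) \<Rightarrow> bool" where
  "am_convex_on J \<alpha> m g \<longleftrightarrow>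
    (\<forall>x\<in>J. \<forall>y\<in>J. \<forall>t\<in>{0..1}.
      g (t * x + m * (1 - t) * y) \<le> t powr \<alpha> * g x + m * (1 - t powr \<alpha>) * g y)"

definition am_convex_dominated_on ::
    "real set \<Rightarrow> (real \<Rightarrow> real) \<Rightarrow> real \<Rightarrow> real \<Rightarrow> (real \<Rightarrow> real) \<Rightarrow> bool" where
  "am_convex_dominated_on J g \<alpha> m f \<longleftrightarrow>
    (\<forall>x\<in>J. \<forall>y\<in>J. \<forall>l\<in>{0..1}.
      \<bar>l powr \<alpha> * f x + m * (1 - l powr \<alpha>) * f y - f (l * x + m * (1 - l) * y)\<bar>
        \<le> l powr \<alpha> * g x + m * (1 - l powr \<alpha>) * g y - g (l * x + m * (1 - l) * y))"

end

theory Submission imports Defs begin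

text \<open>
  Each \<open>x \<in> {a..b}\<close> equals both \<open>p * a + m * (1 - p) * (b / m)\<close> and
  \<open>q * b + m * (1 - q) * (a / m)\<close> with the barycentric weights \<open>p = (b - x) / (b - a)\<close> and
  \<open>q = (x - a) / (b - a)\<close>. Domination, applied to both representations and added up, bounds
  \<open>\<bar>D f x\<bar>\<close> by \<open>D g x\<close>, where \<open>D h x\<close> is the sum of the two defects
  \<open>p\<^sup>\<alpha> h(a) + m (1 - p\<^sup>\<alpha>) h(b/m) - h(x)\<close> and \<open>q\<^sup>\<alpha> h(b) + m (1 - q\<^sup>\<alpha>) h(a/m) - h(x)\<close>. Since the
  means of \<open>p\<^sup>\<alpha>\<close> and \<open>q\<^sup>\<alpha>\<close> over the interval are both \<open>1 / (\<alpha> + 1)\<close>, the integral of \<open>D h\<close> is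
  \<open>2 (b - a)\<close> times the functional of \<open>h\<close> that occurs on each side of the theorem, and
  integrating the pointwise bound proves it.

  The integration needs \<open>g\<close> to be integrable, and this has to come from convexity alone.
  Taking \<open>0\<close> as the second point in the convexity inequality makes
  \<open>(g x - m * g 0) / x powr \<alpha>\<close> monotone on the positive half-line, which yields measurability
  (\<open>am_convex_on_borel_measurable\<close>). The same choice bounds \<open>g\<close> from above on \<open>{0..b}\<close>; a lower
  bound follows by representing \<open>b\<close> as a combination of \<open>2 * b\<close> and an arbitrary point of
  \<open>{0..b}\<close> (\<open>am_convex_on_bounded\<close>).
\<close>

section \<open>Integrability of \<open>(\<alpha>, m)\<close>-convex functions\<close>

lemma am_convex_onD:
  assumes "am_convex_on J \<alpha> m g" "x \<in> J" "y \<in> J" "0 \<le> t" "t \<le> 1"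
  shows "g (t * x + m * (1 - t) * y) \<le> t powr \<alpha> * g x + m * (1 - t powr \<alpha>) * g y"
  using assms by (auto simp: am_convex_on_def)

text \<open>
  For \<open>0 < x \<le> y\<close> this is the convexity inequality at the points \<open>y\<close> and \<open>0\<close> with weight
  \<open>x / y\<close>. Subtracting \<open>m * g 0\<close> absorbs the contribution of the point \<open>0\<close>; the case
  \<open>\<alpha> = m = 1\<close> is the monotonicity of the slope of a convex function at the origin.
\<close>

lemma am_convex_on_powr_quotient_mono:
  assumes g: "am_convex_on {0..} \<alpha> m g"
  shows "mono_on {0<..} (\<lambda>x. (g x - m * g 0) / x powr \<alpha>)"
proof (rule mono_onI)
  fix x y :: real
  assume xy: "x \<in> {0<..}" "y \<in> {0<..}" "x \<le> y"
  have "g (x / y * y + m * (1 - x / y) * 0)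
        \<le> (x / y) powr \<alpha> * g y + m * (1 - (x / y) powr \<alpha>) * g 0"
    using xy by (intro am_convex_onD[OF g]) auto
  then have "g x - m * g 0 \<le> (x powr \<alpha> / y powr \<alpha>) * (g y - m * g 0)"
    using xy by (simp add: powr_divide right_diff_distrib) (simp add: algebra_simps)
  then show "(g x - m * g 0) / x powr \<alpha> \<le> (g y - m * g 0) / y powr \<alpha>"
    using xy by (simp add: field_simps)
qed

text \<open>
  On the positive half-line \<open>g\<close> is recovered from the monotone quotient by multiplying with
  \<open>x powr \<alpha>\<close>. At \<open>0\<close>, where the quotient says nothing, the value is restored by an indicator.
\<close>

lemma am_convex_on_borel_measurable:
  assumes g: "am_convex_on {0..} \<alpha> m g" and "0 \<le> a"
  shows "g \<in> borel_measurable (lebesgue_on {a..b})"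
proof -
  let ?k = "\<lambda>x. (g x - m * g 0) / x powr \<alpha>"
  have k: "?k \<in> borel_measurable (restrict_space borel {0<..})"
    by (rule borel_measurable_mono_on_fnc[OF am_convex_on_powr_quotient_mono[OF g]])
  then have "(\<lambda>x. indicator {0<..} x *\<^sub>R ?k x) \<in> borel_measurable borel"
    by (subst (asm) borel_measurable_restrict_space_iff) simp_all
  then have "(\<lambda>x. m * g 0 + (indicator {0<..} x *\<^sub>R ?k x) * x powr \<alpha>
                  + indicator {0} x * (g 0 - m * g 0)) \<in> borel_measurable borel"
    by measurable
  then have "(\<lambda>x. m * g 0 + (indicator {0<..} x *\<^sub>R ?k x) * x powr \<alpha>
                  + indicator {0} x * (g 0 - m * g 0)) \<in> borel_measurable (lebesgue_on {a..b})"
    by (simp add: measurable_completion measurable_restrict_space1)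
  then show ?thesis
    by (rule measurable_cong[THEN iffD1, rotated])
      (use \<open>0 \<le> a\<close> in \<open>auto simp: indicator_def\<close>)
qed

text \<open>
  Convexity directly gives upper bounds only. It also bounds \<open>g y\<close> from below once \<open>y\<close> takes
  part, with a weight bounded away from \<open>0\<close>, in a combination that produces a fixed point. Here
  the fixed point is \<open>b\<close> and the partner of \<open>y\<close> is \<open>2 * b\<close>: as \<open>m * y \<le> b\<close>, the weight \<open>t\<close> of
  \<open>2 * b\<close> is at most \<open>1 / 2\<close>.
\<close>

lemma am_convex_on_bounded:
  assumes \<alpha>: "0 < \<alpha>" and m: "0 < m" "m \<le> 1" and g: "am_convex_on {0..} \<alpha> m g" and "0 < b"
  shows "\<exists>B. \<forall>y\<in>{0..b}. \<bar>g y\<bar> \<le> B"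
proof -
  \<comment> \<open>the least possible weight of \<open>g y\<close> in the lower estimate\<close>
  define c where "c = m * (1 - (1 / 2) powr \<alpha>)"
  have half: "(1 / 2) powr \<alpha> < (1::real)"
    using powr_less_mono2[of \<alpha> "1/2" 1] \<alpha> by simp
  have c: "0 < c"
    using half m by (simp add: c_def)
  have upper: "g y \<le> \<bar>g b\<bar> + \<bar>g 0\<bar>" if y: "y \<in> {0..b}" for y
  proof -
    define s where "s = (y / b) powr \<alpha>"
    have s: "0 \<le> s" "s \<le> 1"
      using y \<open>0 < b\<close> \<alpha> by (auto simp: s_def intro!: powr_le1)
    have "g (y / b * b + m * (1 - y / b) * 0) \<le> s * g b + m * (1 - s) * g 0"
      unfolding s_def using y \<open>0 < b\<close> by (intro am_convex_onD[OF g]) auto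
    also have "\<dots> \<le> 1 * \<bar>g b\<bar> + 1 * \<bar>g 0\<bar>"
    proof (rule add_mono)
      show "s * g b \<le> 1 * \<bar>g b\<bar>"
        using mult_mono[of s 1 "\<bar>g b\<bar>" "\<bar>g b\<bar>"] mult_left_mono[of "g b" "\<bar>g b\<bar>" s] s by linarith
      have "m * (1 - s) \<le> 1" "0 \<le> m * (1 - s)"
        using s m by (auto intro: mult_le_one)
      then show "m * (1 - s) * g 0 \<le> 1 * \<bar>g 0\<bar>"
        using mult_mono[of "m * (1 - s)" 1 "\<bar>g 0\<bar>" "\<bar>g 0\<bar>"]
          mult_left_mono[of "g 0" "\<bar>g 0\<bar>" "m * (1 - s)"] by linarith
    qed
    finally show ?thesis using \<open>0 < b\<close> by simp
  qed
  have lower: "- ((\<bar>g b\<bar> + \<bar>g (2 * b)\<bar>) / c) \<le> g y" if y: "y \<in> {0..b}" for y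
  proof (cases "0 \<le> g y")
    case True
    then show ?thesis using c by (smt (verit) divide_nonneg_pos)
  next
    case False
    \<comment> \<open>the solution of \<open>t * (2 * b) + m * (1 - t) * y = b\<close>\<close>
    define t where "t = (b - m * y) / (2 * b - m * y)"
    have my: "m * y \<le> b" "0 \<le> m * y"
      using y m mult_mono[of m 1 y b] by auto
    have t: "0 \<le> t" "t \<le> 1 / 2"
      using my \<open>0 < b\<close> by (auto simp: t_def field_simps)
    have tb: "t * (2 * b) + m * (1 - t) * y = b"
    proof -
      have "t * (2 * b - m * y) = b - m * y"
        using my \<open>0 < b\<close> by (simp add: t_def)
      then show ?thesis by (simp add: algebra_simps)
    qed
    have tp: "t powr \<alpha> \<le> (1 / 2) powr \<alpha>" "0 \<le> t powr \<alpha>"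
      using t \<alpha> by (auto intro: powr_mono2)
    have "g b \<le> t powr \<alpha> * g (2 * b) + m * (1 - t powr \<alpha>) * g y"
      using am_convex_onD[OF g, of "2 * b" y t] t y \<open>0 < b\<close> tb by simp
    also have "t powr \<alpha> * g (2 * b) \<le> \<bar>g (2 * b)\<bar>"
      using mult_mono[of "t powr \<alpha>" 1 "\<bar>g (2 * b)\<bar>" "\<bar>g (2 * b)\<bar>"]
        mult_left_mono[of "g (2 * b)" "\<bar>g (2 * b)\<bar>" "t powr \<alpha>"] tp half by linarith
    also have "m * (1 - t powr \<alpha>) * g y \<le> c * g y"
      using tp m False by (intro mult_right_mono_neg) (auto simp: c_def)
    finally have "- (\<bar>g b\<bar> + \<bar>g (2 * b)\<bar>) \<le> c * g y" by linarith
    then show ?thesis using c by (simp add: field_simps)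
  qed
  have "\<bar>g y\<bar> \<le> max (\<bar>g b\<bar> + \<bar>g 0\<bar>) ((\<bar>g b\<bar> + \<bar>g (2 * b)\<bar>) / c)" if "y \<in> {0..b}" for y
    using upper[OF that] lower[OF that] by linarith
  then show ?thesis by blast
qed

lemma am_convex_on_set_integrable:
  assumes "0 < \<alpha>" "0 < m" "m \<le> 1" and g: "am_convex_on {0..} \<alpha> m g" and "0 \<le> a" "a < b"
  shows "set_integrable lebesgue {a..b} g"
proof -
  obtain B where "\<And>y. y \<in> {0..b} \<Longrightarrow> \<bar>g y\<bar> \<le> B"
    using am_convex_on_bounded[of \<alpha> m g b] assms by fastforce
  then show ?thesis
    using assms(5) am_convex_on_borel_measurable[OF g \<open>0 \<le> a\<close>]
    by (intro measurable_bounded_by_integrable_imp_absolutely_integrable[where g = "\<lambda>_. B"]) auto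
qed

section \<open>Integrating the defect\<close>

lemma has_integral_barycentric_powr:
  fixes a b \<alpha> :: real
  assumes "0 < \<alpha>" "a < b"
  shows "((\<lambda>x. ((x - a) / (b - a)) powr \<alpha>) has_integral (b - a) / (\<alpha> + 1)) {a..b}"
proof -
  define F where "F = (\<lambda>x. (b - a) / (\<alpha> + 1) * ((x - a) / (b - a)) powr (\<alpha> + 1))"
  have "((\<lambda>x. ((x - a) / (b - a)) powr \<alpha>) has_integral F b - F a) {a..b}"
  proof (rule fundamental_theorem_of_calculus_interior)
    show "continuous_on {a..b} F"
      unfolding F_def using assms by (intro continuous_intros continuous_on_powr') auto
    fix x assume x: "x \<in> {a<..<b}"
    have "(F has_real_derivative ((x - a) / (b - a)) powr \<alpha>) (at x)"
      unfolding F_def using x assms by (auto intro!: derivative_eq_intros)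
    then show "(F has_vector_derivative ((x - a) / (b - a)) powr \<alpha>) (at x)"
      by (simp add: has_real_derivative_iff_has_vector_derivative)
  qed (use assms in auto)
  moreover have "F b - F a = (b - a) / (\<alpha> + 1)"
    using assms by (simp add: F_def)
  ultimately show ?thesis by simp
qed

lemma has_integral_barycentric_powr_reflected:
  fixes a b \<alpha> :: real
  assumes "0 < \<alpha>" "a < b"
  shows "((\<lambda>x. ((b - x) / (b - a)) powr \<alpha>) has_integral (b - a) / (\<alpha> + 1)) {a..b}"
proof -
  have "((\<lambda>x. ((b - (- x)) / (b - a)) powr \<alpha>) has_integral (b - a) / (\<alpha> + 1)) {- b..- a}"
    using has_integral_barycentric_powr[of \<alpha> "- b" "- a"] assms by (simp add: add.commute)
  then show ?thesis
    by (subst (asm) has_integral_reflect_real) auto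
qed

text \<open>
  Of the weight \<open>w\<close> only its mean \<open>1 / (\<alpha> + 1)\<close> matters; the complementary weight \<open>1 - w\<close> then has
  mean \<open>\<alpha> / (\<alpha> + 1)\<close>, which is the source of the factor \<open>m * \<alpha>\<close> in the theorem. Leaving \<open>w\<close> open
  covers both barycentric coordinates.
\<close>

lemma has_integral_chord_defect:
  fixes h :: "real \<Rightarrow> real"
  assumes "0 < \<alpha>" "a < b" and h: "set_integrable lebesgue {a..b} h"
    and w: "(w has_integral (b - a) / (\<alpha> + 1)) {a..b}"
  shows "((\<lambda>x. w x * u + m * (1 - w x) * v - h x)
          has_integral (b - a) * ((u + m * \<alpha> * v) / (\<alpha> + 1)) - (LINT x:{a..b}|lebesgue. h x)) {a..b}"
proof -
  have "(h has_integral (LINT x:{a..b}|lebesgue. h x)) {a..b}"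
    using h by (simp add: has_integral_set_lebesgue)
  moreover have "((\<lambda>x. w x * (u - m * v) + m * v)
      has_integral (b - a) / (\<alpha> + 1) * (u - m * v) + (b - a) * (m * v)) {a..b}"
    using has_integral_add[OF has_integral_mult_left[OF w] has_integral_const_real[of "m * v" a b]]
      \<open>a < b\<close> by simp
  ultimately have "((\<lambda>x. w x * (u - m * v) + m * v - h x)
      has_integral (b - a) / (\<alpha> + 1) * (u - m * v) + (b - a) * (m * v)
        - (LINT x:{a..b}|lebesgue. h x)) {a..b}"
    by (rule has_integral_diff[rotated])
  moreover have "(b - a) / (\<alpha> + 1) * (u - m * v) + (b - a) * (m * v)
       = (b - a) * ((u + m * \<alpha> * v) / (\<alpha> + 1))"
    using \<open>0 < \<alpha>\<close> by (simp add: field_simps)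
  ultimately show ?thesis by (simp add: algebra_simps)
qed

section \<open>The Hadamard-type inequality\<close>

theorem theorem6:
  fixes \<alpha> m a b :: real and f g :: "real \<Rightarrow> real"
  assumes "\<alpha> \<in> {0<..1}" and "m \<in> {0<..1}"
    and "am_convex_on {0..} \<alpha> m g"
    and "am_convex_dominated_on {0..} g \<alpha> m f"
    and "0 \<le> a" and "a < b"
    and "set_integrable lebesgue {a..b} f"
  shows "\<bar>1 / 2 * ((f a + f b + m * \<alpha> * f (a / m) + m * \<alpha> * f (b / m)) / (\<alpha> + 1))
            - 1 / (b - a) * (LINT x:{a..b}|lebesgue. f x)\<bar>
       \<le> 1 / 2 * ((g a + g b + m * \<alpha> * g (a / m) + m * \<alpha> * g (b / m)) / (\<alpha> + 1))
            - 1 / (b - a) * (LINT x:{a..b}|lebesgue. g x)"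
proof -
  have \<alpha>: "0 < \<alpha>" and m: "0 < m" "m \<le> 1" using assms(1,2) by auto
  have gi: "set_integrable lebesgue {a..b} g"
    using am_convex_on_set_integrable[OF \<alpha> m assms(3,5,6)] .
  define p where "p = (\<lambda>x. (b - x) / (b - a))"
  define q where "q = (\<lambda>x. (x - a) / (b - a))"
  let ?I = "\<lambda>h. LINT x:{a..b}|lebesgue. h x"
  define D where "D = (\<lambda>h x. (p x powr \<alpha> * h a + m * (1 - p x powr \<alpha>) * h (b / m) - h x)
                        + (q x powr \<alpha> * h b + m * (1 - q x powr \<alpha>) * h (a / m) - h x))"
  define M where "M = (\<lambda>h. 1 / 2 * ((h a + h b + m * \<alpha> * h (a / m) + m * \<alpha> * h (b / m)) / (\<alpha> + 1))
            - 1 / (b - a) * ?I h)"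
  have D_int: "(D h has_integral 2 * (b - a) * M h) {a..b}"
    if "set_integrable lebesgue {a..b} h" for h
  proof -
    have split: "2 * (b - a) * (1 / 2 * y - z) = (b - a) * y - 2 * ((b - a) * z)" for y z
      by (simp add: algebra_simps)
    have scale: "(b - a) * (1 / (b - a) * y) = y" for y
      using \<open>a < b\<close> by simp
    have "2 * (b - a) * M h = (b - a) * ((h a + h b + m * \<alpha> * h (a / m) + m * \<alpha> * h (b / m)) / (\<alpha> + 1))
        - 2 * ((b - a) * (1 / (b - a) * ?I h))"
      unfolding M_def by (rule split)
    also have "\<dots> = ((b - a) * ((h a + m * \<alpha> * h (b / m)) / (\<alpha> + 1)) - ?I h)
        + ((b - a) * ((h b + m * \<alpha> * h (a / m)) / (\<alpha> + 1)) - ?I h)"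
      unfolding scale by (simp add: add_divide_distrib distrib_left)
    finally have M_eq: "2 * (b - a) * M h = \<dots>" .
    show ?thesis
      unfolding M_eq D_def p_def q_def
      by (intro has_integral_add
          has_integral_chord_defect[OF \<alpha> \<open>a < b\<close> that has_integral_barycentric_powr_reflected[OF \<alpha> \<open>a < b\<close>]]
          has_integral_chord_defect[OF \<alpha> \<open>a < b\<close> that has_integral_barycentric_powr[OF \<alpha> \<open>a < b\<close>]])
  qed
  have dom: "\<bar>D f x\<bar> \<le> D g x" if x: "x \<in> {a..b}" for x
  proof -
    have pq: "p x \<in> {0..1}" "q x \<in> {0..1}"
      using x \<open>a < b\<close> by (auto simp: p_def q_def field_simps)
    have 1: "1 - p x = q x" "1 - q x = p x"
      using \<open>a < b\<close> by (simp_all add: p_def q_def diff_divide_distrib[symmetric] diff_divide_eq_iff)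
    have "p x * a + q x * b = (x * (b - a)) / (b - a)"
      by (simp add: p_def q_def add_divide_distrib[symmetric] algebra_simps)
    then have "p x * a + q x * b = x" using \<open>a < b\<close> by simp
    then have x1: "p x * a + (1 - p x) * b = x" and x2: "q x * b + (1 - q x) * a = x"
      unfolding 1 by (simp_all add: add.commute)
    have x1': "p x * a + m * (1 - p x) * (b / m) = x" and x2': "q x * b + m * (1 - q x) * (a / m) = x"
      using x1 x2 m by auto
    have nn: "a \<in> {0..}" "b \<in> {0..}" "a / m \<in> {0..}" "b / m \<in> {0..}"
      using \<open>0 \<le> a\<close> \<open>a < b\<close> m by auto
    note d = assms(4)[unfolded am_convex_dominated_on_def, rule_format]
    show ?thesis
      using d[OF nn(1) nn(4) pq(1)] d[OF nn(2) nn(3) pq(2)] unfolding x1' x2' D_def by linarith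
  qed
  have "\<bar>2 * (b - a) * M f\<bar> \<le> 2 * (b - a) * M g"
    using integral_norm_bound_integral[of "D f" "{a..b}" "D g"] dom
      D_int[OF assms(7)] D_int[OF gi] by (simp add: integral_unique has_integral_integrable)
  then have "\<bar>M f\<bar> \<le> M g"
    using \<open>a < b\<close> by (simp add: abs_mult)
  then show ?thesis by (simp add: M_def)
qed

end
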